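(* Let $(\gamma_n)_{n\ge 1}$ be independent random variables, where $\gamma_n$ is a gamma random variable with parameter $n$. Then: (1) For any $\lambda$ with $\Re(\lambda)>-1$, $$\lim_{N\to\infty}\frac{1}{N^{\lambda^2/2}}\,\mathbb{E}\left[\left(\prod_{j=1}^{N}\gamma_j\right)^{\lambda}\right]\exp\left(-\lambda\sum_{j=1}^{N}\psi(j)\right)=\left(A^{\lambda}G(1+\lambda)\right)^{-1},$$ where $A=\sqrt{\dfrac{e}{2\pi}}$, $\psi(z)=\dfrac{\Gamma'(z)}{\Gamma(z)}$, and $G$ is the Barnes G-function. (2) Consequently, from (1) together with the identity in law $$\prod_{j=1}^{N}\gamma_{j}\ \stackrel{\text{law}}{=}\ |Z_N|\prod_{j=1}^{N}\sqrt{\gamma_{j}\gamma_{j}'}$$ (all variables on the right-hand side being independent, with $\gamma_j,\gamma_j'$ gamma variables with parameter $j$), one recovers the limit theorem of Keating and Snaith: for $\Re(\lambda)>-1$, $$\lim_{N\to\infty}\frac{1}{N^{\lambda^2}}\,\mathbb{E}_N\left[|Z_N|^{2\lambda}\right]=\frac{\left(G(1+\lambda)\right)^2}{G(1+2\lambda)},$$ where $Z_N=\det(I-\Lambda)$ and $\mathbb{E}_N$ is the expectation when $\Lambda$ is distributed according to the Haar probability measure on the unitary group $U(N)$.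
   Context: A gamma variable $\gamma_a$ with parameter $a>0$ has law $\mathbb{P}(\gamma_a\in dt)=\frac{t^{a-1}e^{-t}}{\Gamma(a)}\,dt$ on $t>0$. The Barnes G-function is defined by $$G(1+z)=(2\pi)^{z/2}\exp\left[-\tfrac12\left((1+\gamma)z^2+z\right)\right]\prod_{n=1}^{\infty}\left(1+\frac{z}{n}\right)^{n}\exp\left[-z+\frac{z^2}{2n}\right],$$ where $\gamma$ (without index) is Euler's constant. $\Gamma$ is the Euler Gamma function. $U(N)$ is the group of $N\times N$ unitary matrices, and $Z_N$ is the value at the point $1$ of the characteristic polynomial of a random unitary matrix.
   Formalization: In (2) the expectation of |Z_N|^{2λ} diverges for Re(λ) ≤ -1/2, so the limit is stated for Re(λ) > -1/2, and for Re(λ) > -1, λ ≠ -1/2, with the expectation replaced by its analytic continuation; the identity in law is taken as a premise. *)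

theory Defs
  imports "HOL-Probability.Probability" "Jordan_Normal_Form.Schur_Decomposition"
begin

definition gamma_density :: "real \<Rightarrow> real \<Rightarrow> real" where
  "gamma_density a t = (if t > 0 then t powr (a - 1) * exp (- t) / Gamma a else 0)"

definition gamma_law :: "real \<Rightarrow> real measure" where
  "gamma_law a = density lborel (\<lambda>t. ennreal (gamma_density a t))"

(* The factor with index k is the factor n = k + 1 of the usual product. The library's notion of
   convergence of an infinite product permits finitely many vanishing factors, so the value is 0
   at w = 0, -1, -2, ... *)
definition barnes_G :: "complex \<Rightarrow> complex" where
  "barnes_G w = (let z = w - 1 in
     complex_of_real (2 * pi) powr (z / 2)
     * exp (- (1 / 2) * ((1 + euler_mascheroni) * z\<^sup>2 + z))
     * (\<Prod>k. (1 + z / of_nat (Suc k)) ^ Suc k * exp (- z + z\<^sup>2 / (2 * of_nat (Suc k)))))"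

(* The library's Digamma is the logarithmic derivative of Gamma. *)
lemma Digamma_eq_log_deriv:
  fixes x :: real
  assumes "x > 0"
  shows "Digamma x = deriv Gamma x / Gamma x"
proof -
  have "x \<notin> \<int>\<^sub>\<le>\<^sub>0" using assms by (auto elim!: nonpos_Ints_cases)
  then have "deriv Gamma x = Gamma x * Digamma x"
    by (intro DERIV_imp_deriv has_field_derivative_Gamma)
  moreover have "Gamma x \<noteq> 0" using assms by (simp add: Gamma_real_pos less_imp_neq[symmetric])
  ultimately show ?thesis by simp
qed

definition unitary_group :: "nat \<Rightarrow> complex mat set" where
  "unitary_group N = {U \<in> carrier_mat N N. U * mat_adjoint U = 1\<^sub>m N \<and> mat_adjoint U * U = 1\<^sub>m N}"

(* The Borel sigma-algebra of U(N), generated by the matrix entries, i.e. by the embedding of U(N)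
   into the finite product of copies of the complex plane indexed by the entries. The matrix type
   carries no topology of its own. *)
definition unitary_borel :: "nat \<Rightarrow> complex mat measure" where
  "unitary_borel N =
     vimage_algebra (unitary_group N)
       (\<lambda>U. \<lambda>(i, j) \<in> {..<N} \<times> {..<N}. U $$ (i, j))
       (PiM ({..<N} \<times> {..<N}) (\<lambda>_. borel))"

definition haar_unitary :: "nat \<Rightarrow> complex mat measure \<Rightarrow> bool" where
  "haar_unitary N \<mu> \<longleftrightarrow>
     prob_space \<mu> \<and> sets \<mu> = sets (unitary_borel N) \<and>
     (\<forall>V \<in> unitary_group N. distr \<mu> \<mu> (\<lambda>U. V * U) = \<mu>)"

definition Z :: "nat \<Rightarrow> complex mat \<Rightarrow> complex" where
  "Z N \<Lambda> = Determinant.det (1\<^sub>m N - \<Lambda>)"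

(* Law of |Z_N| * prod_{j=1..N} sqrt (gamma_j * gamma'_j) with Z_N, gamma_j, gamma'_j all
   independent: independence is expressed by taking the product measure. *)
definition unitary_gamma_product_law :: "nat \<Rightarrow> complex mat measure \<Rightarrow> real measure" where
  "unitary_gamma_product_law N \<mu> =
     distr (\<mu> \<Otimes>\<^sub>M (PiM {1..N} (\<lambda>j. gamma_law (real j)) \<Otimes>\<^sub>M PiM {1..N} (\<lambda>j. gamma_law (real j)))) borel
       (\<lambda>(\<Lambda>, g, g'). cmod (Z N \<Lambda>) * (\<Prod>j = 1..N. sqrt (g j * g' j)))"

end

(* The moment of the product of the first N gamma variables is the product of the ratios
   Gamma(j + z) / Gamma(j), which rearranges to
     (Gamma(N + 1 + z) / N!)^N / prod_{k <= N} (1 + z/k)^k.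
   The denominator is, up to an exponential, the partial product defining G(1 + z). In the numerator
   a_N = Gamma(N + 1 + z) / (N! N^z) satisfies a_N^N -> exp((z^2 + z)/2), because
   ln a_N - ln a_{N+1} ~ (z^2 + z) / (2 N^2). Together with N (H_N - ln N - gamma) -> 1/2 this gives the
   first limit. For the second one, apply |x|^(2s) to the identity in law and use Fubini: the moment
   of |Z_N| is the quotient of the moments at 2s and at s (squared). That quotient of Gamma functions
   is also the analytic continuation, whose only singularity with Re s > -1 is the pole of Gamma(1 + 2s). *)

theory Submission
  imports Defs "HOL-Real_Asymp.Real_Asymp"
begin

section \<open>Asymptotics of the Gamma function\<close>

text \<open>Taylor's theorem of order two on the closed disc of radius 1/2. There |1 + x| >= 1/2, so
  the third derivative 2/(1 + x)^3 is at most 16 in norm; the remainder carries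
  \<open>fact 2\<close>, whence the constant 16/2 = 8.\<close>

lemma Ln_approx_quadratic:
  fixes w :: complex
  assumes "norm w \<le> 1 / 2"
  shows "norm (Ln (1 + w) - w + w\<^sup>2 / 2) \<le> 8 * norm w ^ 3"
proof -
  define f :: "nat \<Rightarrow> complex \<Rightarrow> complex" where
    "f = (\<lambda>i x. if i = 0 then Ln (1 + x) else if i = 1 then inverse (1 + x)
      else if i = 2 then - inverse ((1 + x)\<^sup>2) else 2 * inverse ((1 + x) ^ 3))"
  have lower: "norm (1 + x) \<ge> 1 / 2" and re: "Re (1 + x) > 0" if "x \<in> cball 0 (1 / 2)" for x :: complex
  proof -
    have "norm (1::complex) \<le> norm (1 + x) + norm x"
      by (metis add_diff_cancel_right' norm_triangle_ineq4)
    then show "norm (1 + x) \<ge> 1 / 2" using that by auto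
    show "Re (1 + x) > 0" using that abs_Re_le_cmod[of x] by auto
  qed
  have "norm (f 0 w - (\<Sum>i\<le>2. f i 0 * (w - 0) ^ i / fact i)) \<le> 16 * norm (w - 0) ^ Suc 2 / fact 2"
  proof (rule complex_Taylor)
    show "(f i has_field_derivative f (Suc i) x) (at x within cball 0 (1 / 2))"
      if x: "x \<in> cball 0 (1 / 2)" and "i \<le> 2" for i x
    proof -
      have ne: "1 + x \<noteq> 0" using lower[OF x] by auto
      have nn: "1 + x \<notin> \<real>\<^sub>\<le>\<^sub>0" using re[OF x] by (auto simp: complex_nonpos_Reals_iff)
      consider "i = 0" | "i = 1" | "i = 2" using \<open>i \<le> 2\<close> by linarith
      then show ?thesis
      proof cases
        case 1
        then show ?thesis using ne nn unfolding f_def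
          by (auto intro!: derivative_eq_intros simp: field_simps)
      next
        case 2
        then show ?thesis using ne unfolding f_def
          by (auto intro!: derivative_eq_intros simp: power2_eq_square)
      next
        case 3
        \<comment> \<open>The left side is the derivative of \<open>- inverse (y\<^sup>2)\<close> in
          the shape produced by the derivative rules.\<close>
        have "- (- (inverse (y\<^sup>2) * (2 * y) * inverse (y\<^sup>2))) = 2 * inverse (y ^ 3)" if "y \<noteq> 0" for y :: complex
          using that by (simp add: field_simps power2_eq_square power3_eq_cube)
        note eq = this[OF ne]
        have "((\<lambda>x. - inverse ((1 + x)\<^sup>2)) has_field_derivative 2 * inverse ((1 + x) ^ 3)) (at x within cball 0 (1 / 2))"
          unfolding eq[symmetric] using ne by (auto intro!: derivative_eq_intros)
        then show ?thesis using 3 unfolding f_def by simp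
      qed
    qed
    show "norm (f (Suc 2) x) \<le> 16" if x: "x \<in> cball 0 (1 / 2)" for x
    proof -
      have "inverse (norm (1 + x)) \<le> 2"
        using le_imp_inverse_le[OF lower[OF x]] by simp
      then have "inverse (norm (1 + x)) ^ 3 \<le> 2 ^ 3"
        by (intro power_mono) auto
      then show ?thesis by (simp add: f_def norm_mult norm_inverse norm_power power_inverse)
    qed
  qed (use assms in auto)
  then show ?thesis
    by (simp add: f_def numeral_2_eq_2 power3_eq_cube algebra_simps)
qed

text \<open>A Stolz--Cesaro argument: subtract \<open>c / n\<close> from \<open>v\<close> and telescope the remaining differences
  against those of \<open>1 / n\<close>.\<close>

lemma stolz_cesaro_inverse:
  fixes v :: "nat \<Rightarrow> 'a::real_normed_field"
  assumes v: "v \<longlonglongrightarrow> 0"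
    and d: "(\<lambda>n. of_nat n ^ 2 * (v n - v (Suc n))) \<longlonglongrightarrow> c"
  shows "(\<lambda>n. of_nat n * v n) \<longlonglongrightarrow> c"
proof -
  define w where "w = (\<lambda>n. v n - c * inverse (of_nat n))"
  have inv0: "(\<lambda>n. inverse (of_nat n) :: 'a) \<longlonglongrightarrow> 0"
    by (rule lim_inverse_n)
  have w0: "w \<longlonglongrightarrow> 0"
    using tendsto_diff[OF v tendsto_mult_left[OF inv0, of c]] by (simp add: w_def)
  \<comment> \<open>The subtracted term equals n^2 (c/n - c/(n+1)) and tends to c, so the scaled
    differences of \<open>w\<close> tend to 0.\<close>
  have "(\<lambda>n. of_nat n ^ 2 * (v n - v (Suc n)) - c * inverse (1 + inverse (of_nat n))) \<longlonglongrightarrow> c - c * inverse (1 + 0)"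
    by (intro tendsto_intros d inv0) auto
  moreover have "\<forall>\<^sub>F n in sequentially.
      of_nat n ^ 2 * (v n - v (Suc n)) - c * inverse (1 + inverse (of_nat n)) = of_nat n ^ 2 * (w n - w (Suc n))"
    using eventually_gt_at_top[of 0]
  proof eventually_elim
    case (elim n)
    have *: "c * inverse (1 + inverse a) = a ^ 2 * (c * inverse a - c * inverse (1 + a))"
      if "a \<noteq> 0" "1 + a \<noteq> 0" for a :: 'a
    proof -
      have "1 + inverse a = (1 + a) / a" "inverse a - inverse (1 + a) = 1 / (a * (1 + a))"
        using that by (simp_all add: divide_simps)
      then show ?thesis
        using that by (simp add: power2_eq_square flip: right_diff_distrib)
    qed
    have "1 + of_nat n \<noteq> (0::'a)" by (metis of_nat_Suc of_nat_eq_0_iff nat.distinct(1))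
    with *[of "of_nat n"] have "c * inverse (1 + inverse (of_nat n)) = of_nat n ^ 2 * (c * inverse (of_nat n) - c * inverse (of_nat (Suc n)))"
      using elim by simp
    then show ?case by (simp add: w_def algebra_simps)
  qed
  ultimately have dw: "(\<lambda>n. of_nat n ^ 2 * (w n - w (Suc n))) \<longlonglongrightarrow> 0"
    by (simp add: tendsto_cong)
  have nw: "(\<lambda>n. of_nat n * w n) \<longlonglongrightarrow> 0"
  proof (rule LIMSEQ_I)
    fix e :: real assume e: "e > 0"
    \<comment> \<open>Since 1/n^2 <= 2/(n (n+1)), the margin e/4 becomes e/2 times a difference of
      reciprocals; the telescoped bound e/2 is then strictly below e.\<close>
    obtain K where K: "\<And>n. n \<ge> K \<Longrightarrow> norm (of_nat n ^ 2 * (w n - w (Suc n))) < e / 4"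
      using LIMSEQ_D[OF dw, of "e / 4"] e by auto
    have step: "norm (w n - w (Suc n)) \<le> e / 2 * (1 / real n - 1 / real (Suc n))" if "n \<ge> K" "n > 0" for n
    proof -
      have "real n ^ 2 * norm (w n - w (Suc n)) \<le> e / 4"
        using K[OF that(1)] by (simp add: norm_mult norm_power)
      then have "norm (w n - w (Suc n)) \<le> e / 4 / real n ^ 2"
        using that(2) by (simp add: field_simps)
      also have "\<dots> = e / 2 * (1 / (real n * (2 * real n)))"
        by (simp add: power2_eq_square)
      also have "\<dots> \<le> e / 2 * (1 / (real n * real (Suc n)))"
        using that(2) e by (intro mult_left_mono frac_le) auto
      also have "1 / (real n * real (Suc n)) = 1 / real n - 1 / real (Suc n)"
        using that(2) by (simp add: field_simps)
      finally show ?thesis .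
    qed
    have tele: "norm (w n - w (n + m)) \<le> e / 2 * (1 / real n - 1 / real (n + m))" if "n \<ge> K" "n > 0" for n m
    proof (induction m)
      case (Suc m)
      have "norm (w n - w (n + Suc m)) \<le> norm (w n - w (n + m)) + norm (w (n + m) - w (Suc (n + m)))"
        using norm_triangle_ineq[of "w n - w (n + m)" "w (n + m) - w (Suc (n + m))"] by simp
      also have "\<dots> \<le> e / 2 * (1 / real n - 1 / real (n + m)) + e / 2 * (1 / real (n + m) - 1 / real (Suc (n + m)))"
        using Suc step[of "n + m"] that by (intro add_mono) auto
      finally show ?case by (simp add: algebra_simps)
    qed simp
    \<comment> \<open>Because \<open>w\<close> tends to 0, letting m grow in the telescoped estimate
      removes \<open>w (n + m)\<close>.\<close>
    have bound: "norm (w n) \<le> e / 2 / real n" if n: "n \<ge> K" "n > 0" for n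
    proof (rule LIMSEQ_le_const2)
      have "(\<lambda>m. w (n + m)) \<longlonglongrightarrow> 0"
        using LIMSEQ_ignore_initial_segment[OF w0, of n] by (simp add: add.commute)
      then show "(\<lambda>m. norm (w n - w (n + m))) \<longlonglongrightarrow> norm (w n)"
        by (auto intro!: tendsto_eq_intros)
      have "e / 2 * (1 / real n - 1 / real (n + m)) \<le> e / 2 / real n" for m
      proof -
        have "e / 2 * (1 / real n - 1 / real (n + m)) \<le> e / 2 * (1 / real n)"
          using e by (intro mult_left_mono) auto
        then show ?thesis by simp
      qed
      then show "\<exists>N. \<forall>m\<ge>N. norm (w n - w (n + m)) \<le> e / 2 / real n"
        using tele[OF n] order_trans by blast
    qed
    have "norm (of_nat n * w n - 0) < e" if "n \<ge> max 1 K" for n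
    proof -
      have "norm (of_nat n * w n - 0) = real n * norm (w n)" by (simp add: norm_mult)
      also have "\<dots> \<le> e / 2" using bound[of n] that by (simp add: field_simps)
      finally show ?thesis using e by simp
    qed
    then show "\<exists>no. \<forall>n\<ge>no. norm (of_nat n * w n - 0) < e" by blast
  qed
  have "(\<lambda>n. of_nat n * w n + c) \<longlonglongrightarrow> 0 + c"
    by (intro tendsto_intros nw)
  moreover have "\<forall>\<^sub>F n in sequentially. of_nat n * w n + c = of_nat n * v n"
    using eventually_gt_at_top[of 0] by eventually_elim (simp add: w_def algebra_simps)
  ultimately show ?thesis by (simp add: tendsto_cong)
qed

text \<open>By Stolz-Cesaro it suffices that consecutive differences, ln(1 + 1/n) - 1/(n+1), equal
  1/(2 n^2) to leading order.\<close>

lemma harm_asymptotics: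
  "(\<lambda>n. real n * (harm n - ln (real n) - euler_mascheroni)) \<longlonglongrightarrow> 1 / 2"
proof (rule stolz_cesaro_inverse)
  show "(\<lambda>n. harm n - ln (real n) - euler_mascheroni) \<longlonglongrightarrow> 0"
    using euler_mascheroni_LIMSEQ by (simp add: LIM_zero)
  have "(\<lambda>n. real n ^ 2 * (ln (real (Suc n)) - ln (real n) - 1 / real (Suc n))) \<longlonglongrightarrow> 1 / 2"
    by real_asymp
  moreover have "real n ^ 2 * (ln (real (Suc n)) - ln (real n) - 1 / real (Suc n)) =
      real n ^ 2 * (harm n - ln (real n) - euler_mascheroni - (harm (Suc n) - ln (real (Suc n)) - euler_mascheroni))" for n
    by (simp add: harm_Suc inverse_eq_divide)
  ultimately show "(\<lambda>n. real n ^ 2 * (harm n - ln (real n) - euler_mascheroni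
      - (harm (Suc n) - ln (real (Suc n)) - euler_mascheroni))) \<longlonglongrightarrow> 1 / 2"
    by (simp only:)
qed

text \<open>Only the quadratic Taylor term survives: after multiplication by n^2 the cubic remainder
  is O(1/n). The sequence \<open>b\<close> in the proof is the negative of that quadratic
  term.\<close>

lemma Ln_one_plus_div_asymptotics:
  fixes z :: complex
  shows "(\<lambda>n. of_nat n ^ 2 * (Ln (1 + z / of_nat (Suc n)) - z / of_nat (Suc n))) \<longlonglongrightarrow> - (z\<^sup>2 / 2)"
proof -
  define b where "b = (\<lambda>n. (of_nat n / of_nat (Suc n)) ^ 2 * (z\<^sup>2 / 2))"
  have "(\<lambda>n. of_nat n ^ 2 * (Ln (1 + z / of_nat (Suc n)) - z / of_nat (Suc n)) + b n) \<longlonglongrightarrow> 0"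
  proof (rule Lim_null_comparison)
    have "(\<lambda>n. norm z / real (Suc n)) \<longlonglongrightarrow> 0" by real_asymp
    then have "\<forall>\<^sub>F n in sequentially. norm z / real (Suc n) < 1 / 2"
      by (rule order_tendstoD) simp
    then show "\<forall>\<^sub>F n in sequentially.
        norm (of_nat n ^ 2 * (Ln (1 + z / of_nat (Suc n)) - z / of_nat (Suc n)) + b n)
          \<le> real n ^ 2 * (8 * (norm z / real (Suc n)) ^ 3)"
    proof eventually_elim
      case (elim n)
      define w where "w = z / of_nat (Suc n)"
      have nw: "norm w = norm z / real (Suc n)"
        unfolding w_def norm_divide norm_of_nat ..
      have "b n = of_nat n ^ 2 * (w\<^sup>2 / 2)"
        by (simp add: b_def w_def power_divide)
      then have "of_nat n ^ 2 * (Ln (1 + w) - w) + b n = of_nat n ^ 2 * (Ln (1 + w) - w + w\<^sup>2 / 2)"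
        by (simp add: algebra_simps)
      also have "norm \<dots> \<le> real n ^ 2 * (8 * norm w ^ 3)"
        unfolding norm_mult norm_power norm_of_nat
        using elim nw by (intro mult_left_mono Ln_approx_quadratic) auto
      finally show ?case unfolding nw unfolding w_def .
    qed
    have "(\<lambda>n. real n ^ 2 / real (Suc n) ^ 3) \<longlonglongrightarrow> 0" by real_asymp
    from tendsto_mult_right_zero[OF this, of "8 * norm z ^ 3"]
    show "(\<lambda>n. real n ^ 2 * (8 * (norm z / real (Suc n)) ^ 3)) \<longlonglongrightarrow> 0"
      by (simp add: power_divide mult_ac del: of_nat_Suc)
  qed
  moreover have "b \<longlonglongrightarrow> z\<^sup>2 / 2"
  proof -
    have "(\<lambda>n. of_nat n / of_nat (Suc n) :: complex) \<longlonglongrightarrow> 1" by (rule LIMSEQ_n_over_Suc_n)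
    then have "b \<longlonglongrightarrow> 1 ^ 2 * (z\<^sup>2 / 2)"
      unfolding b_def by (intro tendsto_mult tendsto_power tendsto_const)
    then show ?thesis by simp
  qed
  ultimately show ?thesis
    using tendsto_diff by fastforce
qed

section \<open>Shifted Gamma quotients and their N-th powers\<close>

text \<open>This is the Gauss limit for Gamma(1 + z), with the Pochhammer symbol written as a
  quotient of Gamma values. The power n^z is spelled as an exponential: with \<open>ln 0 = 0\<close>
  it is 1 at n = 0, so the quotient is nonzero for every n.\<close>

lemma Gamma_shift_ratio_tendsto_1:
  fixes z :: complex
  assumes z: "1 + z \<notin> \<int>\<^sub>\<le>\<^sub>0"
  shows "(\<lambda>n. Gamma (1 + z + of_nat n) / (fact n * exp (z * of_real (ln (real n))))) \<longlonglongrightarrow> 1"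
proof -
  have G: "Gamma (1 + z) \<noteq> 0" using z by (simp add: Gamma_eq_zero_iff)
  have "(\<lambda>n. Gamma (1 + z) / Gamma_series' (1 + z) n) \<longlonglongrightarrow> Gamma (1 + z) / Gamma (1 + z)"
    by (intro tendsto_intros Gamma_series'_LIMSEQ G)
  moreover have "\<forall>\<^sub>F n in sequentially. Gamma (1 + z) / Gamma_series' (1 + z) n =
      Gamma (1 + z + of_nat n) / (fact n * exp (z * of_real (ln (real n))))"
    using eventually_gt_at_top[of 0]
  proof eventually_elim
    case (elim n)
    have "exp ((1 + z) * of_real (ln (real n))) = of_nat n * exp (z * of_real (ln (real n)))"
      using elim by (simp add: ring_distribs exp_add exp_of_real)
    moreover have "fact n = of_nat n * (fact (n - 1) :: complex)"
      using elim by (simp add: fact_reduce)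
    ultimately show ?case
      using G z by (simp add: Gamma_series'_def pochhammer_Gamma field_simps)
  qed
  ultimately show ?thesis using G by (simp add: tendsto_cong)
qed

text \<open>Subtracting n from a nonpositive integer leaves a nonpositive integer, so shifting 1 + z
  upwards cannot reach a pole of Gamma. This also keeps every factor of the Barnes product
  nonzero.\<close>

lemma one_plus_notin_nonpos_Ints_shift:
  fixes z :: complex
  assumes "1 + z \<notin> \<int>\<^sub>\<le>\<^sub>0"
  shows "1 + z / of_nat (Suc n) \<noteq> 0" "1 + z + of_nat n \<noteq> 0" "1 + z + of_nat n \<notin> \<int>\<^sub>\<le>\<^sub>0"
proof -
  show nn: "1 + z + of_nat n \<notin> \<int>\<^sub>\<le>\<^sub>0"
    using assms nonpos_Ints_diff_Nats[OF _ of_nat_in_Nats[of n], of "1 + z + of_nat n"] by auto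
  then show "1 + z + of_nat n \<noteq> 0" by auto
  have "(of_nat (Suc n) :: complex) \<noteq> 0" by (rule of_nat_neq_0)
  moreover have "of_nat (Suc n) + z \<noteq> 0" using \<open>1 + z + of_nat n \<noteq> 0\<close> by (simp add: algebra_simps)
  ultimately show "1 + z / of_nat (Suc n) \<noteq> 0"
    by (simp add: add_divide_eq_iff del: of_nat_Suc)
qed

text \<open>Stolz-Cesaro applied to the logarithms of the quotients gives the limit of n times the
  logarithm; exponentiating turns this into the n-th power.\<close>

lemma Gamma_shift_ratio_power_tendsto:
  fixes z :: complex
  assumes z: "1 + z \<notin> \<int>\<^sub>\<le>\<^sub>0"
  shows "(\<lambda>n. (Gamma (1 + z + of_nat n) / (fact n * exp (z * of_real (ln (real n))))) ^ n)
           \<longlonglongrightarrow> exp ((z\<^sup>2 + z) / 2)"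
proof -
  define a where "a = (\<lambda>n. Gamma (1 + z + of_nat n) / (fact n * exp (z * of_real (ln (real n)))))"
  \<comment> \<open>By the recursion Gamma(x + 1) = x Gamma(x), \<open>u n\<close> is a logarithm of
    a(n+1)/a(n).\<close>
  define u where "u = (\<lambda>n. Ln (1 + z / of_nat (Suc n)) - z * of_real (ln (real (Suc n)) - ln (real n)))"
  have a1: "a \<longlonglongrightarrow> 1" unfolding a_def by (rule Gamma_shift_ratio_tendsto_1[OF z])
  have a0: "a n \<noteq> 0" for n
    using one_plus_notin_nonpos_Ints_shift(3)[OF z] by (simp add: a_def Gamma_eq_zero_iff)
  have Ln0: "(\<lambda>n. Ln (a n)) \<longlonglongrightarrow> 0"
    using tendsto_Ln[OF a1] by simp
  have step: "a (Suc n) = a n * exp (u n)" for n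
  proof -
    have "Gamma (1 + z + of_nat (Suc n)) = (1 + z + of_nat n) * Gamma (1 + z + of_nat n)"
      using Gamma_plus1[OF one_plus_notin_nonpos_Ints_shift(3)[OF z, of n]] by (simp add: add_ac)
    moreover have "exp (u n) = (1 + z / of_nat (Suc n)) * (exp (z * of_real (ln (real n))) / exp (z * of_real (ln (real (Suc n)))))"
      using one_plus_notin_nonpos_Ints_shift(1)[OF z, of n]
      by (simp add: u_def exp_diff ring_distribs del: of_nat_Suc)
    moreover have "1 + z / of_nat (Suc n) = (1 + z + of_nat n) / of_nat (Suc n)"
      using of_nat_neq_0[of n, where ?'a = complex] by (simp add: field_simps)
    ultimately show ?thesis
      by (simp add: a_def mult_ac del: of_nat_Suc)
  qed
  \<comment> \<open>Adding and subtracting z/(n+1) splits -u(n): the complex logarithm contributes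
    z^2/2, and ln(1 + 1/n) - 1/(n+1) contributes z/2.\<close>
  have "(\<lambda>n. - (of_nat n ^ 2 * (Ln (1 + z / of_nat (Suc n)) - z / of_nat (Suc n)))
           + z * of_real (real n ^ 2 * (ln (real (Suc n)) - ln (real n) - 1 / real (Suc n))))
        \<longlonglongrightarrow> - (- (z\<^sup>2 / 2)) + z * of_real (1 / 2)"
    by (intro tendsto_intros Ln_one_plus_div_asymptotics) real_asymp
  moreover have "- (of_nat n ^ 2 * (Ln (1 + z / of_nat (Suc n)) - z / of_nat (Suc n)))
           + z * of_real (real n ^ 2 * (ln (real (Suc n)) - ln (real n) - 1 / real (Suc n))) = of_nat n ^ 2 * (- u n)" for n
    unfolding u_def of_real_mult of_real_diff of_real_power of_real_divide of_real_of_nat_eq of_real_1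
    by (simp add: algebra_simps del: of_nat_Suc)
  ultimately have nu: "(\<lambda>n. of_nat n ^ 2 * (- u n)) \<longlonglongrightarrow> (z\<^sup>2 + z) / 2"
    by (simp add: add_divide_distrib)
  have u0: "u \<longlonglongrightarrow> 0"
  proof -
    have "(\<lambda>n. Ln (1 + of_real (1 / real (Suc n)) * z) - z * of_real (ln (real (Suc n)) - ln (real n)))
            \<longlonglongrightarrow> Ln (1 + of_real 0 * z) - z * of_real 0"
      by (intro tendsto_intros) (real_asymp | simp)+
    then show ?thesis by (simp add: u_def)
  qed
  have "(\<lambda>n. Ln (a n) + u n) \<longlonglongrightarrow> 0 + 0"
    by (intro tendsto_intros Ln0 u0)
  \<comment> \<open>An imaginary part below pi in absolute value rules out a jump of the branch, so
    the principal logarithm is additive here for large n.\<close>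
  then have "\<forall>\<^sub>F n in sequentially. norm (Ln (a n) + u n) < pi"
    by (intro order_tendstoD(2)[OF tendsto_norm]) auto
  then have "\<forall>\<^sub>F n in sequentially. of_nat n ^ 2 * (- u n) = of_nat n ^ 2 * (Ln (a n) - Ln (a (Suc n)))"
  proof eventually_elim
    case (elim n)
    have "\<bar>Im (Ln (a n) + u n)\<bar> < pi" using abs_Im_le_cmod elim by (rule le_less_trans)
    then have "Ln (exp (Ln (a n) + u n)) = Ln (a n) + u n"
      by (intro Ln_exp) auto
    moreover have "exp (Ln (a n) + u n) = a (Suc n)"
      using a0 by (simp add: exp_add step)
    ultimately show ?case by simp
  qed
  with nu have "(\<lambda>n. of_nat n ^ 2 * (Ln (a n) - Ln (a (Suc n)))) \<longlonglongrightarrow> (z\<^sup>2 + z) / 2"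
    by (simp add: tendsto_cong)
  from tendsto_exp[OF stolz_cesaro_inverse[OF Ln0 this]]
  have "(\<lambda>n. exp (of_nat n * Ln (a n))) \<longlonglongrightarrow> exp ((z\<^sup>2 + z) / 2)" .
  moreover have "exp (of_nat n * Ln (a n)) = a n ^ n" for n
    using a0 by (simp add: exp_of_nat_mult)
  ultimately show ?thesis by (simp add: a_def)
qed

section \<open>The Barnes G-function and moments of products of gamma variables\<close>

definition barnes_factor :: "complex \<Rightarrow> nat \<Rightarrow> complex" where
  "barnes_factor z k = (1 + z / of_nat (Suc k)) ^ Suc k * exp (- z + z\<^sup>2 / (2 * of_nat (Suc k)))"

lemma barnes_G_one_plus:
  "barnes_G (1 + z) = of_real (2 * pi) powr (z / 2) * exp (- (1 / 2) * ((1 + euler_mascheroni) * z\<^sup>2 + z))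
     * prodinf (barnes_factor z)"
  unfolding barnes_G_def barnes_factor_def[abs_def] by (simp add: Let_def)

text \<open>With m = k + 1, each factor is the exponential of m times the cubic Taylor remainder of
  Ln(1 + z/m), which is O(1/m^2). The exponents are thus summable, and exponentiating the sum gives
  a convergent product of nonzero factors.\<close>

lemma barnes_factor_convergent:
  assumes z: "1 + z \<notin> \<int>\<^sub>\<le>\<^sub>0"
  shows "convergent_prod (barnes_factor z)" "barnes_factor z k \<noteq> 0"
proof -
  define g where "g = (\<lambda>k. of_nat (Suc k) * (Ln (1 + z / of_nat (Suc k)) - z / of_nat (Suc k) + (z / of_nat (Suc k))\<^sup>2 / 2))"
  have f_exp: "barnes_factor z = (\<lambda>k. exp (g k))"
  proof
    fix k
    define m where "m = Suc k"
    have m: "of_nat m \<noteq> (0::complex)" unfolding m_def by (rule of_nat_neq_0)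
    have "g k = of_nat m * Ln (1 + z / of_nat m) + (- z + z\<^sup>2 / (2 * of_nat m))"
      using m unfolding g_def m_def[symmetric]
      by (simp add: field_simps power2_eq_square)
    moreover have "exp (Ln (1 + z / of_nat m)) = 1 + z / of_nat m"
      unfolding m_def by (rule exp_Ln[OF one_plus_notin_nonpos_Ints_shift(1)[OF z]])
    ultimately show "barnes_factor z k = exp (g k)"
      unfolding barnes_factor_def m_def[symmetric] by (simp only: exp_add exp_of_nat_mult)
  qed
  have "summable g"
  proof (rule summable_comparison_test_ev)
    have "(\<lambda>n. norm z / real (Suc n)) \<longlonglongrightarrow> 0" by real_asymp
    then have "\<forall>\<^sub>F n in sequentially. norm z / real (Suc n) < 1 / 2"
      by (rule order_tendstoD) simp
    then show "\<forall>\<^sub>F n in sequentially. norm (g n) \<le> 8 * norm z ^ 3 * (1 / real (Suc n) ^ 2)"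
    proof eventually_elim
      case (elim n)
      have "norm (g n) \<le> real (Suc n) * (8 * norm (z / of_nat (Suc n)) ^ 3)"
        unfolding g_def norm_mult norm_of_nat
        using elim by (intro mult_left_mono Ln_approx_quadratic) (simp_all add: norm_divide del: of_nat_Suc)
      also have "\<dots> = 8 * norm z ^ 3 * (1 / real (Suc n) ^ 2)"
        by (simp add: norm_divide power_divide power2_eq_square power3_eq_cube del: of_nat_Suc)
      finally show ?case .
    qed
    have "summable (\<lambda>n. 1 / real (Suc n) ^ 2)"
      using inverse_power_summable[of 2, where ?'a = real]
      by (subst summable_Suc_iff) (simp add: inverse_eq_divide)
    then show "summable (\<lambda>n. 8 * norm z ^ 3 * (1 / real (Suc n) ^ 2))"
      by (rule summable_mult)
  qed
  then show "convergent_prod (barnes_factor z)"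
    unfolding f_exp convergent_prod_def using sums_imp_has_prod_exp summable_sums by blast
  show "barnes_factor z k \<noteq> 0" unfolding f_exp by simp
qed

lemma barnes_factor_LIMSEQ:
  assumes z: "1 + z \<notin> \<int>\<^sub>\<le>\<^sub>0"
  shows "(\<lambda>n. \<Prod>k<n. barnes_factor z k) \<longlonglongrightarrow> prodinf (barnes_factor z)" "prodinf (barnes_factor z) \<noteq> 0"
  using convergent_prod_LIMSEQ[OF barnes_factor_convergent(1)[OF z]]
    prodinf_nonzero[OF barnes_factor_convergent[OF z]]
  by (simp_all add: LIMSEQ_lessThan_iff_atMost)

lemma barnes_G_one_plus_nonzero:
  assumes z: "1 + z \<notin> \<int>\<^sub>\<le>\<^sub>0"
  shows "barnes_G (1 + z) \<noteq> 0"
  using barnes_factor_LIMSEQ(2)[OF z] by (simp add: barnes_G_one_plus)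

text \<open>Separates the algebraic part of the partial product from the convergence factors, whose
  exponents add up to a harmonic number.\<close>

lemma prod_barnes_factor:
  "(\<Prod>k<n. barnes_factor z k) =
     (\<Prod>k<n. (1 + z / of_nat (Suc k)) ^ Suc k) * exp (- z * of_nat n + z\<^sup>2 / 2 * of_real (harm n))"
proof (induction n)
  case 0
  show ?case by (simp add: harm_def)
next
  case (Suc n)
  have "- z * of_nat (Suc n) = - z * of_nat n + - z"
    by (simp add: ring_distribs)
  moreover have "z\<^sup>2 / 2 * of_real (harm (Suc n)) = z\<^sup>2 / 2 * of_real (harm n) + z\<^sup>2 / (2 * of_nat (Suc n))"
    by (simp add: harm_Suc distrib_left inverse_eq_divide del: of_nat_Suc)
  ultimately have "exp (- z * of_nat (Suc n) + z\<^sup>2 / 2 * of_real (harm (Suc n))) =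
      exp (- z * of_nat n + z\<^sup>2 / 2 * of_real (harm n)) * exp (- z + z\<^sup>2 / (2 * of_nat (Suc n)))"
    by (simp only: exp_add mult_ac)
  then show ?case
    unfolding prod.lessThan_Suc Suc barnes_factor_def[of z n] by (simp only: mult_ac)
qed

section \<open>Products of Gamma ratios and their asymptotics\<close>

definition gamma_prod_moment :: "nat \<Rightarrow> complex \<Rightarrow> complex" where
  "gamma_prod_moment N z = (\<Prod>j = 1..N. Gamma (of_nat j + z) / Gamma (of_nat j))"

text \<open>Write B for the base on the right and q = 1 + z/(N+1). Passing to N + 1 multiplies the
  moment by B and the product by q^(N+1), while the base becomes B q; and B^N B q^(N+1) = (B
  q)^(N+1).\<close>

lemma gamma_prod_moment_times_prod:
  assumes z: "1 + z \<notin> \<int>\<^sub>\<le>\<^sub>0"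
  shows "gamma_prod_moment N z * (\<Prod>k<N. (1 + z / of_nat (Suc k)) ^ Suc k) =
           (Gamma (1 + z + of_nat N) / fact N) ^ N"
proof (induction N)
  case 0
  show ?case by (simp add: gamma_prod_moment_def)
next
  case (Suc N)
  define B where "B = Gamma (1 + z + of_nat N) / fact N"
  have ne: "of_nat (Suc N) \<noteq> (0::complex)" by (rule of_nat_neq_0)
  have "Gamma (1 + z + of_nat (Suc N)) = (1 + z + of_nat N) * Gamma (1 + z + of_nat N)"
    using Gamma_plus1[OF one_plus_notin_nonpos_Ints_shift(3)[OF z, of N]] by (simp add: add_ac)
  moreover have "1 + z / of_nat (Suc N) = (1 + z + of_nat N) / of_nat (Suc N)"
    using ne by (simp add: field_simps)
  ultimately have B: "Gamma (1 + z + of_nat (Suc N)) / fact (Suc N) = B * (1 + z / of_nat (Suc N))"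
    by (simp add: B_def mult_ac del: of_nat_Suc)
  have M: "gamma_prod_moment (Suc N) z = gamma_prod_moment N z * B"
    by (simp add: gamma_prod_moment_def B_def Gamma_fact add_ac)
  have IH: "gamma_prod_moment N z * (\<Prod>k<N. (1 + z / of_nat (Suc k)) ^ Suc k) = B ^ N"
    using Suc by (simp add: B_def)
  have "gamma_prod_moment (Suc N) z * (\<Prod>k<Suc N. (1 + z / of_nat (Suc k)) ^ Suc k) =
      (gamma_prod_moment N z * (\<Prod>k<N. (1 + z / of_nat (Suc k)) ^ Suc k)) * B * (1 + z / of_nat (Suc N)) ^ Suc N"
    unfolding M prod.lessThan_Suc by (simp only: mult_ac)
  also have "\<dots> = (B * (1 + z / of_nat (Suc N))) ^ Suc N"
    unfolding IH power_mult_distrib power_Suc2[of B] ..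
  finally show ?case
    unfolding B .
qed

text \<open>Digamma at N + 1 is H_N minus Euler's constant, and (N+1) H_{N+1} = (N+1) H_N + 1 sums
  the harmonic numbers.\<close>

lemma sum_Digamma_of_nat:
  "(\<Sum>j = 1..N. Digamma (real j)) = real N * (harm N - 1 - euler_mascheroni)"
proof (induction N)
  case (Suc N)
  have "Digamma (real (Suc N)) = harm N - euler_mascheroni"
    by (rule Digamma_of_nat)
  moreover have "real (Suc N) * harm (Suc N) = real (Suc N) * harm N + 1"
    by (simp add: harm_Suc distrib_left del: of_nat_Suc)
  ultimately show ?case using Suc by (simp add: algebra_simps)
qed simp

text \<open>The normalised moment is regrouped into pieces with known limits: the N-th power of the
  Gamma quotient, the reciprocal partial Barnes product, and an exponential in which the divergent
  terms have cancelled.\<close>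

lemma gamma_prod_moment_asymptotics:
  assumes z: "1 + z \<notin> \<int>\<^sub>\<le>\<^sub>0"
  shows "(\<lambda>N. 1 / of_nat N powr (z\<^sup>2 / 2) * gamma_prod_moment N z
            * exp (- z * of_real (\<Sum>j = 1..N. Digamma (real j))))
          \<longlonglongrightarrow> inverse (of_real (sqrt (exp 1 / (2 * pi))) powr z * barnes_G (1 + z))"
proof -
  define P where "P = prodinf (barnes_factor z)"
  define a where "a = (\<lambda>n. Gamma (1 + z + of_nat n) / (fact n * exp (z * of_real (ln (real n)))))"
  define PN where "PN = (\<lambda>N. \<Prod>k<N. barnes_factor z k)"
  have P: "PN \<longlonglongrightarrow> P" "P \<noteq> 0"
    using barnes_factor_LIMSEQ[OF z] by (simp_all add: PN_def P_def)
  have PN0: "PN N \<noteq> 0" for N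
    using barnes_factor_convergent(2)[OF z] by (simp add: PN_def)
  have T: "(\<lambda>N. a N ^ N / PN N * exp (- z * of_real (real N * (harm N - ln (real N) - euler_mascheroni))
           + z\<^sup>2 / 2 * of_real (harm N - ln (real N))))
        \<longlonglongrightarrow> exp ((z\<^sup>2 + z) / 2) / P * exp (- z * of_real (1 / 2) + z\<^sup>2 / 2 * of_real euler_mascheroni)"
    unfolding a_def
    by (intro tendsto_intros P Gamma_shift_ratio_power_tendsto[OF z] harm_asymptotics euler_mascheroni_LIMSEQ)
  have C: "exp ((z\<^sup>2 + z) / 2) / P * exp (- z * of_real (1 / 2) + z\<^sup>2 / 2 * of_real euler_mascheroni) =
      inverse (of_real (sqrt (exp 1 / (2 * pi))) powr z * barnes_G (1 + z))"
  proof -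
    have "of_real (sqrt (exp 1 / (2 * pi))) powr z = exp (z * of_real ((1 - ln (2 * pi)) / 2))"
      by (simp add: powr_def Ln_of_real ln_sqrt ln_div)
    moreover have "of_real (2 * pi) powr (z / 2) = exp (z * of_real (ln (2 * pi) / 2))"
      using Ln_of_real[of "2 * pi"] by (simp add: powr_def)
    ultimately have "of_real (sqrt (exp 1 / (2 * pi))) powr z * barnes_G (1 + z) =
        exp (z * of_real ((1 - ln (2 * pi)) / 2) + z * of_real (ln (2 * pi) / 2)
          + - (1 / 2) * ((1 + euler_mascheroni) * z\<^sup>2 + z)) * P"
      unfolding barnes_G_one_plus P_def by (simp only: exp_add mult_ac)
    \<comment> \<open>The powers of 2 pi in A^z and G(1 + z) cancel, and so do the linear terms in
      z; this is why A has this value.\<close>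
    also have "z * of_real ((1 - ln (2 * pi)) / 2) + z * of_real (ln (2 * pi) / 2)
          + - (1 / 2) * ((1 + euler_mascheroni) * z\<^sup>2 + z) = - ((1 + euler_mascheroni) * z\<^sup>2 / 2)"
      by (simp add: field_simps)
    finally have AG: "of_real (sqrt (exp 1 / (2 * pi))) powr z * barnes_G (1 + z) =
        exp (- ((1 + euler_mascheroni) * z\<^sup>2 / 2)) * P" .
    have "exp ((z\<^sup>2 + z) / 2) / P * exp (- z * of_real (1 / 2) + z\<^sup>2 / 2 * of_real euler_mascheroni) =
        exp ((z\<^sup>2 + z) / 2 + (- z * of_real (1 / 2) + z\<^sup>2 / 2 * of_real euler_mascheroni)) / P"
      unfolding exp_add by simp
    also have "(z\<^sup>2 + z) / 2 + (- z * of_real (1 / 2) + z\<^sup>2 / 2 * of_real euler_mascheroni) =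
        (1 + euler_mascheroni) * z\<^sup>2 / 2"
      by (simp add: ring_distribs add_divide_distrib mult.commute)
    also have "exp \<dots> / P = inverse (of_real (sqrt (exp 1 / (2 * pi))) powr z * barnes_G (1 + z))"
      unfolding AG by (simp only: exp_minus inverse_mult_distrib inverse_inverse_eq divide_inverse)
    finally show ?thesis .
  qed
  have Ev: "\<forall>\<^sub>F N in sequentially.
      a N ^ N / PN N * exp (- z * of_real (real N * (harm N - ln (real N) - euler_mascheroni))
           + z\<^sup>2 / 2 * of_real (harm N - ln (real N))) =
      1 / of_nat N powr (z\<^sup>2 / 2) * gamma_prod_moment N z
            * exp (- z * of_real (\<Sum>j = 1..N. Digamma (real j)))"
    using eventually_gt_at_top[of 0]
  proof eventually_elim
    case (elim N)
    define L where "L = complex_of_real (ln (real N))"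
    define H where "H = complex_of_real (harm N)"
    define Q where "Q = (\<Prod>k<N. (1 + z / of_nat (Suc k)) ^ Suc k)"
    have Q: "PN N = Q * exp (- z * of_nat N + z\<^sup>2 / 2 * H)"
      unfolding PN_def Q_def H_def by (rule prod_barnes_factor)
    then have "Q \<noteq> 0" using PN0[of N] by auto
    have "(Gamma (1 + z + of_nat N) / fact N) = a N * exp (z * L)"
      by (simp add: a_def L_def)
    then have "gamma_prod_moment N z * Q = (a N * exp (z * L)) ^ N"
      using gamma_prod_moment_times_prod[OF z, of N] by (simp add: Q_def)
    then have "gamma_prod_moment N z * Q = a N ^ N * exp (of_nat N * (z * L))"
      by (simp only: power_mult_distrib exp_of_nat_mult)
    then have "gamma_prod_moment N z = a N ^ N * exp (of_nat N * (z * L)) / Q"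
      using \<open>Q \<noteq> 0\<close> by (simp add: field_simps)
    also have "\<dots> = a N ^ N * exp (of_nat N * (z * L)) * exp (- z * of_nat N + z\<^sup>2 / 2 * H) / PN N"
      unfolding Q by simp
    finally have R: "gamma_prod_moment N z =
      a N ^ N / PN N * exp (of_nat N * (z * L) + (- z * of_nat N + z\<^sup>2 / 2 * H))"
      by (simp add: exp_add)
    \<comment> \<open>Here N > 0 matters: \<open>0 powr x\<close> is 0, never an
      exponential.\<close>
    have "of_nat N powr (z\<^sup>2 / 2) = exp (z\<^sup>2 / 2 * L)"
      using elim Ln_of_real[of "real N"] by (simp add: powr_def L_def)
    then have W: "1 / of_nat N powr (z\<^sup>2 / 2) = exp (- (z\<^sup>2 / 2 * L))"
      by (simp add: exp_minus field_simps)
    have D: "complex_of_real (\<Sum>j = 1..N. Digamma (real j)) = of_nat N * (H - 1 - euler_mascheroni)"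
      unfolding sum_Digamma_of_nat H_def by simp
    \<comment> \<open>The terms -z N and +z N cancel. What remains involves only N (H_N - ln N -
      gamma) and H_N - ln N, both convergent.\<close>
    have E: "- (z\<^sup>2 / 2 * L) + (of_nat N * (z * L) + (- z * of_nat N + z\<^sup>2 / 2 * H))
            + - z * (of_nat N * (H - 1 - euler_mascheroni)) =
        - z * of_real (real N * (harm N - ln (real N) - euler_mascheroni)) + z\<^sup>2 / 2 * of_real (harm N - ln (real N))"
      by (simp add: H_def L_def algebra_simps diff_divide_distrib)
    have "x * exp (u + v + w) = exp u * (x * exp v) * exp w" for x u v w :: complex
      by (simp add: exp_add)
    then show ?case
      unfolding R W D E[symmetric] .
  qed
  show ?thesis by (rule Lim_transform_eventually[OF T[unfolded C] Ev])
qed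

section \<open>Gamma laws and Haar measure\<close>

text \<open>With the absolute value the power is multiplicative on all of the real line, so no almost-sure
  positivity has to be established under the product measure of \<open>unitary_gamma_product_law\<close>.\<close>

definition abs_cpow :: "complex \<Rightarrow> real \<Rightarrow> complex" where
  "abs_cpow s x = of_real \<bar>x\<bar> powr s"

lemma abs_cpow_nonneg: "x \<ge> 0 \<Longrightarrow> of_real x powr s = abs_cpow s x"
  by (simp add: abs_cpow_def)

lemma abs_cpow_mult: "abs_cpow s (x * y) = abs_cpow s x * abs_cpow s y"
  unfolding abs_cpow_def abs_mult of_real_mult by (rule powr_times_real) auto

lemma abs_cpow_prod: "abs_cpow s (\<Prod>i\<in>I. f i) = (\<Prod>i\<in>I. abs_cpow s (f i))"
  by (induction I rule: infinite_finite_induct) (simp_all add: abs_cpow_mult, simp_all add: abs_cpow_def)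

text \<open>Valid for negative x too, because \<open>sqrt\<close> is odd in HOL and so |sqrt x| =
  sqrt |x|. It absorbs the square roots of the identity in law into the exponent 2s.\<close>

lemma abs_cpow_sqrt: "abs_cpow (2 * s) (sqrt x) = abs_cpow s x"
proof (cases "x = 0")
  case False
  then have "sqrt \<bar>x\<bar> > 0" by simp
  then show ?thesis
    using False by (simp add: abs_cpow_def real_sqrt_abs' powr_def Ln_of_real ln_sqrt flip: real_sqrt_abs2)
qed (simp add: abs_cpow_def)

lemma measurable_abs_cpow [measurable]: "abs_cpow s \<in> borel_measurable borel"
proof -
  have "abs_cpow s = (\<lambda>x. if x = 0 then 0 else exp (s * of_real (ln \<bar>x\<bar>)))"
    by (auto simp: abs_cpow_def powr_def Ln_of_real)
  also have "\<dots> \<in> borel_measurable borel" by measurable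
  finally show ?thesis .
qed

text \<open>On the negative axis the principal power differs from \<open>abs_cpow\<close> only by
  the constant factor (-1)^s.\<close>

lemma measurable_of_real_powr [measurable]: "(\<lambda>x::real. of_real x powr (s::complex)) \<in> borel_measurable borel"
proof -
  have "of_real x powr s = (if x < 0 then (- 1) powr s else 1) * abs_cpow s x" for x
    using powr_neg_real_complex[of "- x" s] by (simp add: abs_cpow_def)
  then show ?thesis by simp
qed

lemma gamma_density_measurable [measurable]: "gamma_density a \<in> borel_measurable borel"
  unfolding gamma_density_def[abs_def] by measurable

lemma gamma_density_nonneg: "a \<ge> 0 \<Longrightarrow> gamma_density a t \<ge> 0"
  using Gamma_real_pos[of a] by (cases "a = 0") (auto simp: gamma_density_def)

lemma sets_gamma_law [measurable_cong]: "sets (gamma_law a) = sets borel"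
  by (simp add: gamma_law_def)

section \<open>Moments of gamma variables and of their independent products\<close>

text \<open>Multiplying the density by t^s shifts its exponent, leaving Euler's integral for Gamma(a
  + s) divided by Gamma(a).\<close>

lemma gamma_law_moment:
  assumes a: "a > 0" and s: "Re s > - a"
  shows "has_bochner_integral (gamma_law a) (abs_cpow s) (Gamma (of_real a + s) / Gamma (of_real a))"
proof -
  define f where "f = (\<lambda>t::real. of_real t powr (of_real a + s - 1) / of_real (exp t) :: complex)"
  have re: "Re (of_real a + s) > 0" using s by simp
  have fm: "(\<lambda>t. indicator {0<..} t *\<^sub>R f t) \<in> borel_measurable borel"
    unfolding f_def by measurable
  \<comment> \<open>The Euler integral is available for the completed Lebesgue measure; Borel
    measurability of the integrand carries it over to \<open>lborel\<close>.\<close>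
  have abs: "f absolutely_integrable_on {0<..}"
    unfolding f_def by (rule absolutely_integrable_Gamma_integral'[OF re])
  then have si: "set_integrable lborel {0<..} f"
    unfolding set_integrable_def using fm by (simp add: integrable_completion)
  have "(LINT t : {0<..} | lborel. f t) = integral {0<..} f"
    by (rule set_borel_integral_eq_integral(2)[OF si])
  also have "\<dots> = Gamma (of_real a + s)"
    unfolding f_def by (rule integral_unique[OF Gamma_integral_complex'[OF re]])
  finally have "has_bochner_integral lborel (\<lambda>t. indicator {0<..} t *\<^sub>R f t) (Gamma (of_real a + s))"
    using si by (simp add: has_bochner_integral_iff set_integrable_def set_lebesgue_integral_def)
  then have "has_bochner_integral lborel (\<lambda>t. (indicator {0<..} t *\<^sub>R f t) * inverse (Gamma (of_real a)))
      (Gamma (of_real a + s) * inverse (Gamma (of_real a)))"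
    by (intro has_bochner_integral_mult_left)
  moreover have "(\<lambda>t. (indicator {0<..} t *\<^sub>R f t) * inverse (Gamma (of_real a))) =
      (\<lambda>t. gamma_density a t *\<^sub>R abs_cpow s t)"
  proof
    fix t :: real
    show "(indicator {0<..} t *\<^sub>R f t) * inverse (Gamma (of_real a)) = gamma_density a t *\<^sub>R abs_cpow s t"
    proof (cases "t > 0")
      case True
      have "f t = of_real t powr (of_real (a - 1)) * of_real t powr s / of_real (exp t)"
        unfolding f_def by (simp add: powr_add[symmetric] algebra_simps)
      then have "f t = of_real (t powr (a - 1) * exp (- t)) * abs_cpow s t"
        using True powr_of_real[of t "a - 1"] by (simp add: abs_cpow_def exp_minus divide_inverse)
      then show ?thesis
        using True by (simp add: gamma_density_def scaleR_conv_of_real Gamma_complex_of_real divide_inverse)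
    qed (simp add: gamma_density_def)
  qed
  ultimately show ?thesis
    unfolding gamma_law_def using gamma_density_nonneg[of a] a
    by (intro has_bochner_integral_density) (auto simp: divide_inverse)
qed

text \<open>Independence factors the expectation, since \<open>abs_cpow\<close> is multiplicative.
  The bound Re s > -1 gives Re s > -j for all j >= 1.\<close>

lemma gamma_product_expectation:
  fixes \<gamma> :: "nat \<Rightarrow> 'a \<Rightarrow> real"
  assumes "prob_space M"
    and indep: "prob_space.indep_vars M (\<lambda>_. borel) \<gamma> {1..}"
    and gamma: "\<And>n. n \<ge> 1 \<Longrightarrow> distributed M lborel (\<gamma> n) (\<lambda>t. ennreal (gamma_density (real n) t))"
    and s: "Re s > - 1"
  shows "integrable M (\<lambda>\<omega>. abs_cpow s (\<Prod>j = 1..N. \<gamma> j \<omega>))"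
    and "(LINT \<omega>|M. abs_cpow s (\<Prod>j = 1..N. \<gamma> j \<omega>)) = gamma_prod_moment N s"
proof -
  interpret prob_space M by fact
  have factor: "integrable M (\<lambda>\<omega>. abs_cpow s (\<gamma> j \<omega>))"
       "(LINT \<omega>|M. abs_cpow s (\<gamma> j \<omega>)) = Gamma (of_nat j + s) / Gamma (of_nat j)" if j: "j \<in> {1..N}" for j
  proof -
    have D: "distributed M lborel (\<gamma> j) (\<lambda>t. ennreal (gamma_density (real j) t))"
      using j by (intro gamma) auto
    have law: "distr M lborel (\<gamma> j) = gamma_law (real j)"
      unfolding gamma_law_def by (rule distributed_distr_eq_density[OF D])
    have "has_bochner_integral (distr M lborel (\<gamma> j)) (abs_cpow s)
        (Gamma (of_real (real j) + s) / Gamma (of_real (real j)))"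
      unfolding law using j s by (intro gamma_law_moment) auto
    moreover have "\<gamma> j \<in> measurable M lborel" using D by (rule distributed_measurable)
    ultimately show "integrable M (\<lambda>\<omega>. abs_cpow s (\<gamma> j \<omega>))"
        "(LINT \<omega>|M. abs_cpow s (\<gamma> j \<omega>)) = Gamma (of_nat j + s) / Gamma (of_nat j)"
      by (simp_all add: has_bochner_integral_iff integrable_distr_eq integral_distr)
  qed
  have "indep_vars (\<lambda>_. borel) \<gamma> {1..N}"
    using indep by (rule indep_vars_subset) auto
  then have ind: "indep_vars (\<lambda>_. borel) (\<lambda>j \<omega>. abs_cpow s (\<gamma> j \<omega>)) {1..N}"
    by (rule indep_vars_compose2) auto
  show "integrable M (\<lambda>\<omega>. abs_cpow s (\<Prod>j = 1..N. \<gamma> j \<omega>))"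
    unfolding abs_cpow_prod using indep_vars_integrable[OF _ ind] factor(1) by simp
  show "(LINT \<omega>|M. abs_cpow s (\<Prod>j = 1..N. \<gamma> j \<omega>)) = gamma_prod_moment N s"
    unfolding abs_cpow_prod gamma_prod_moment_def
    using indep_vars_lebesgue_integral[OF _ ind] factor by simp
qed

text \<open>Allows the principal power of the product to be replaced by \<open>abs_cpow\<close>
  almost surely.\<close>

lemma gamma_product_positive_AE:
  fixes \<gamma> :: "nat \<Rightarrow> 'a \<Rightarrow> real"
  assumes "prob_space M"
    and gamma: "\<And>n. n \<ge> 1 \<Longrightarrow> distributed M lborel (\<gamma> n) (\<lambda>t. ennreal (gamma_density (real n) t))"
  shows "AE \<omega> in M. (\<Prod>j = 1..N. \<gamma> j \<omega>) > 0"
proof -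
  interpret prob_space M by fact
  have "AE \<omega> in M. \<gamma> j \<omega> > 0" if "j \<in> {1..N}" for j
    using that by (subst distributed_AE2[OF gamma]) (auto simp: gamma_density_def)
  then have "AE \<omega> in M. \<forall>j\<in>{1..N}. \<gamma> j \<omega> > 0"
    by (intro AE_finite_allI) auto
  then show ?thesis
    by (auto intro: prod_pos elim: eventually_mono)
qed

section \<open>Product measures and measurability of the characteristic polynomial\<close>

lemma (in pair_sigma_finite) integrable_pair_mult:
  fixes f :: "'a \<Rightarrow> complex" and g :: "'b \<Rightarrow> complex"
  assumes f: "integrable M1 f" and g: "integrable M2 g"
  shows "integrable (M1 \<Otimes>\<^sub>M M2) (\<lambda>(x, y). f x * g y)"
proof (rule Fubini_integrable)
  have [measurable]: "f \<in> borel_measurable M1" "g \<in> borel_measurable M2"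
    using f g by auto
  show "(\<lambda>(x, y). f x * g y) \<in> borel_measurable (M1 \<Otimes>\<^sub>M M2)"
    by measurable
  show "integrable M1 (\<lambda>x. LINT y|M2. norm (case (x, y) of (x, y) \<Rightarrow> f x * g y))"
    using f by (simp add: norm_mult)
  show "AE x in M1. integrable M2 (\<lambda>y. case (x, y) of (x, y) \<Rightarrow> f x * g y)"
    using g by simp
qed

lemma (in pair_sigma_finite) integral_pair_mult:
  fixes f :: "'a \<Rightarrow> complex" and g :: "'b \<Rightarrow> complex"
  assumes "integrable (M1 \<Otimes>\<^sub>M M2) (\<lambda>(x, y). f x * g y)"
  shows "integral\<^sup>L (M1 \<Otimes>\<^sub>M M2) (\<lambda>(x, y). f x * g y) = integral\<^sup>L M1 f * integral\<^sup>L M2 g"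
  using integral_fst'[OF assms] by simp

text \<open>Integrating out the second variable leaves the first factor times a nonzero constant,
  which can be divided out. This yields integrability of the power of |Z_N| from that of the whole
  product.\<close>

lemma (in pair_sigma_finite) integrable_pair_mult_fst:
  fixes f :: "'a \<Rightarrow> complex" and g :: "'b \<Rightarrow> complex"
  assumes "integrable (M1 \<Otimes>\<^sub>M M2) (\<lambda>(x, y). f x * g y)" and "integral\<^sup>L M2 g \<noteq> 0"
  shows "integrable M1 f"
proof -
  have fst: "integrable M1 (\<lambda>x. f x * integral\<^sup>L M2 g)"
    using integrable_fst'[OF assms(1)] by simp
  have "integrable M1 (\<lambda>x. f x * integral\<^sup>L M2 g * inverse (integral\<^sup>L M2 g))"
    by (intro integrable_mult_left fst)
  then show ?thesis
    using assms(2) by (simp add: mult.assoc)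
qed

lemma PiM_gamma_law_moment:
  fixes N :: nat
  assumes s: "Re s > - 1"
  defines "G \<equiv> PiM {1..N} (\<lambda>j. gamma_law (real j))"
  shows "integrable G (\<lambda>g. \<Prod>j = 1..N. abs_cpow s (g j))"
    and "(LINT g|G. (\<Prod>j = 1..N. abs_cpow s (g j))) = gamma_prod_moment N s"
    and "sigma_finite_measure G"
proof -
  interpret product_sigma_finite "\<lambda>j. gamma_law (real j)"
  proof (rule product_sigma_finite.intro)
    fix j
    \<comment> \<open>A finite-valued density over a sigma-finite measure suffices; this covers the
      index j = 0 as well.\<close>
    show "sigma_finite_measure (gamma_law (real j))"
      unfolding gamma_law_def
      by (subst sigma_finite_measure.sigma_finite_iff_density_finite[OF sigma_finite_lborel]) auto
  qed
  have m: "has_bochner_integral (gamma_law (real j)) (abs_cpow s) (Gamma (of_nat j + s) / Gamma (of_nat j))"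
    if "j \<in> {1..N}" for j
    using gamma_law_moment[of "real j" s] that s by auto
  show "integrable G (\<lambda>g. \<Prod>j = 1..N. abs_cpow s (g j))"
    unfolding G_def using m by (intro product_integrable_prod) (auto simp: has_bochner_integral_iff)
  show "(LINT g|G. (\<Prod>j = 1..N. abs_cpow s (g j))) = gamma_prod_moment N s"
    unfolding G_def gamma_prod_moment_def using m
    by (subst product_integral_prod) (auto simp: has_bochner_integral_iff)
  show "sigma_finite_measure G"
    unfolding G_def by (rule sigma_finite) simp
qed

text \<open>The Leibniz formula makes the determinant a polynomial in the entries, and the entries
  are coordinates of the map generating the sigma-algebra.\<close>

lemma measurable_Z:
  assumes "sets \<mu> = sets (unitary_borel N)"
  shows "Z N \<in> borel_measurable \<mu>"
proof -
  have entry [measurable]: "(\<lambda>U. U $$ (i, j)) \<in> borel_measurable (unitary_borel N)" if "i < N" "j < N" for i j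
  proof -
    have "(\<lambda>U. \<lambda>(i, j) \<in> {..<N} \<times> {..<N}. U $$ (i, j)) \<in>
        measurable (unitary_borel N) (PiM ({..<N} \<times> {..<N}) (\<lambda>_. borel :: complex measure))"
      unfolding unitary_borel_def by (rule measurable_vimage_algebra1) (auto simp: space_PiM)
    from measurable_compose[OF this measurable_component_singleton[of "(i, j)"]] that
    show ?thesis by simp
  qed
  have "(\<lambda>U. \<Sum>p\<in>{p. p permutes {0..<N}}. signof p * (\<Prod>i = 0..<N. (if i = p i then 1 else 0) - U $$ (i, p i)))
      \<in> borel_measurable (unitary_borel N)"
    by (intro borel_measurable_sum borel_measurable_times borel_measurable_prod borel_measurable_diff
          borel_measurable_const entry) (auto dest: permutes_in_image)
  also have "?this \<longleftrightarrow> Z N \<in> borel_measurable (unitary_borel N)"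
  proof (rule measurable_cong)
    fix U assume "U \<in> space (unitary_borel N)"
    then have U: "U \<in> carrier_mat N N" by (simp add: unitary_borel_def unitary_group_def)
    then have C: "1\<^sub>m N - U \<in> carrier_mat N N" by auto
    show "(\<Sum>p\<in>{p. p permutes {0..<N}}. signof p * (\<Prod>i = 0..<N. (if i = p i then 1 else 0) - U $$ (i, p i))) = Z N U"
      unfolding Z_def det_def'[OF C]
      using U by (intro sum.cong prod.cong arg_cong2[where f = "(*)"] refl) (auto dest: permutes_in_image)
  qed
  finally show ?thesis
    using measurable_cong_sets[OF assms refl] by blast
qed

section \<open>The limit theorems\<close>

text \<open>In HOL, Gamma takes the value 0 exactly at its poles, so avoiding the poles is
  enough.\<close>

lemma gamma_prod_moment_nonzero:
  assumes "1 + s \<notin> \<int>\<^sub>\<le>\<^sub>0"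
  shows "gamma_prod_moment N s \<noteq> 0"
proof -
  have "Gamma (of_nat j + s) \<noteq> 0" if j: "j \<in> {1..N}" for j
  proof -
    from j obtain n where n: "j = Suc n" by (cases j) auto
    show ?thesis
      using one_plus_notin_nonpos_Ints_shift(3)[OF assms, of n] by (simp add: n Gamma_eq_zero_iff add_ac)
  qed
  then show ?thesis
    by (auto simp: gamma_prod_moment_def Gamma_eq_zero_iff of_nat_in_nonpos_Ints_iff)
qed

lemma one_plus_notin_nonpos_Ints:
  assumes "Re s > - 1"
  shows "1 + s \<notin> \<int>\<^sub>\<le>\<^sub>0"
proof
  assume "1 + s \<in> \<int>\<^sub>\<le>\<^sub>0"
  then obtain k where k: "1 + s = of_int k" "k \<le> 0" by (elim nonpos_Ints_cases)
  have "1 + Re s = of_int k" using arg_cong[OF k(1), of Re] by simp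
  then show False using assms k(2) by simp
qed

text \<open>The real part of 1 + 2s exceeds -1, so 0 is the only nonpositive integer it could
  equal.\<close>

lemma one_plus_double_notin_nonpos_Ints:
  assumes "Re s > - 1" "s \<noteq> - 1 / 2"
  shows "1 + 2 * s \<notin> \<int>\<^sub>\<le>\<^sub>0"
proof
  assume "1 + 2 * s \<in> \<int>\<^sub>\<le>\<^sub>0"
  then obtain k where k: "1 + 2 * s = of_int k" "k \<le> 0" by (elim nonpos_Ints_cases)
  have "1 + 2 * Re s = of_int k" using arg_cong[OF k(1), of Re] by simp
  then have "real_of_int k > - 1" using assms(1) by simp
  then have "k = 0" using k(2) by linarith
  then have "2 * s = - 1" using k(1) by (simp add: add_eq_0_iff)
  then have "s = - 1 / 2" by (simp add: field_simps)
  then show False using assms(2) by simp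
qed

lemma unitary_moment:
  fixes \<gamma> :: "nat \<Rightarrow> 'a \<Rightarrow> real"
  assumes "prob_space M"
    and indep: "prob_space.indep_vars M (\<lambda>_. borel) \<gamma> {1..}"
    and gamma: "\<And>n. n \<ge> 1 \<Longrightarrow> distributed M lborel (\<gamma> n) (\<lambda>t. ennreal (gamma_density (real n) t))"
    and haar: "haar_unitary N \<mu>"
    and law: "distr M borel (\<lambda>\<omega>. \<Prod>j = 1..N. \<gamma> j \<omega>) = unitary_gamma_product_law N \<mu>"
    and s: "Re s > - 1 / 2"
  shows "integrable \<mu> (\<lambda>\<Lambda>. of_real (cmod (Z N \<Lambda>)) powr (2 * s))"
    and "(LINT \<Lambda>|\<mu>. of_real (cmod (Z N \<Lambda>)) powr (2 * s)) =
           gamma_prod_moment N (2 * s) / (gamma_prod_moment N s)\<^sup>2"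
proof -
  define G where "G = PiM {1..N} (\<lambda>j. gamma_law (real j))"
  define h where "h = (\<lambda>g :: nat \<Rightarrow> real. \<Prod>j = 1..N. abs_cpow s (g j))"
  \<comment> \<open>The exponent is s for the gamma variables under the square root and 2s for the
    product on the left; the latter forces Re s > -1/2.\<close>
  have res: "Re s > - 1" "Re (2 * s) > - 1" using s by auto
  note PiM = PiM_gamma_law_moment[OF res(1), of N, folded G_def h_def]
  interpret prob_space M by fact
  interpret mu: prob_space \<mu> using haar by (simp add: haar_unitary_def)
  interpret G: sigma_finite_measure G by (rule PiM(3))
  interpret GG: pair_sigma_finite G G ..
  interpret P: pair_sigma_finite \<mu> "G \<Otimes>\<^sub>M G" ..
  have Z [measurable]: "Z N \<in> borel_measurable \<mu>"
    using haar by (intro measurable_Z) (simp add: haar_unitary_def)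
  have \<gamma>m: "\<gamma> j \<in> borel_measurable M" if "j \<in> {1..N}" for j
    using distributed_measurable[OF gamma[of j]] that by simp
  have Xm [measurable]: "(\<lambda>\<omega>. \<Prod>j = 1..N. \<gamma> j \<omega>) \<in> borel_measurable M"
    by (intro borel_measurable_prod \<gamma>m)
  have Gm [measurable]: "(\<lambda>g. g j) \<in> borel_measurable G" if "j \<in> {1..N}" for j
    unfolding G_def using measurable_component_singleton[OF that, of "\<lambda>j. gamma_law (real j)"]
    by (simp add: measurable_cong_sets[OF refl sets_gamma_law])
  have Ym [measurable]: "(\<lambda>(\<Lambda>, g, g'). cmod (Z N \<Lambda>) * (\<Prod>j = 1..N. sqrt (g j * g' j)))
      \<in> borel_measurable (\<mu> \<Otimes>\<^sub>M (G \<Otimes>\<^sub>M G))"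
    by measurable
  have factor: "abs_cpow (2 * s) (case p of (\<Lambda>, g, g') \<Rightarrow> cmod (Z N \<Lambda>) * (\<Prod>j = 1..N. sqrt (g j * g' j))) =
      (case p of (\<Lambda>, q) \<Rightarrow> abs_cpow (2 * s) (cmod (Z N \<Lambda>)) * (case q of (g, g') \<Rightarrow> h g * h g'))" for p
    by (auto simp: h_def abs_cpow_mult abs_cpow_prod abs_cpow_sqrt prod.distrib split: prod.split)
  have law': "distr M borel (\<lambda>\<omega>. \<Prod>j = 1..N. \<gamma> j \<omega>) = distr (\<mu> \<Otimes>\<^sub>M (G \<Otimes>\<^sub>M G)) borel
      (\<lambda>(\<Lambda>, g, g'). cmod (Z N \<Lambda>) * (\<Prod>j = 1..N. sqrt (g j * g' j)))"
    unfolding law unitary_gamma_product_law_def G_def ..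
  have X: "integrable M (\<lambda>\<omega>. abs_cpow (2 * s) (\<Prod>j = 1..N. \<gamma> j \<omega>))"
    "(LINT \<omega>|M. abs_cpow (2 * s) (\<Prod>j = 1..N. \<gamma> j \<omega>)) = gamma_prod_moment N (2 * s)"
    by (intro gamma_product_expectation[OF assms(1) indep] gamma res(2); assumption)+
  have "integrable (distr M borel (\<lambda>\<omega>. \<Prod>j = 1..N. \<gamma> j \<omega>)) (abs_cpow (2 * s))"
    unfolding integrable_distr_eq[OF Xm measurable_abs_cpow] by (rule X(1))
  \<comment> \<open>Integrability of the whole product, transported through the identity in law, is
    what licenses Fubini for the unitary factor.\<close>
  then have int: "integrable (\<mu> \<Otimes>\<^sub>M (G \<Otimes>\<^sub>M G)) (\<lambda>(\<Lambda>, q). abs_cpow (2 * s) (cmod (Z N \<Lambda>)) * (case q of (g, g') \<Rightarrow> h g * h g'))"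
    unfolding law' by (subst (asm) integrable_distr_eq[OF Ym measurable_abs_cpow]) (simp only: factor)
  have hh: "integral\<^sup>L (G \<Otimes>\<^sub>M G) (\<lambda>(g, g'). h g * h g') = (gamma_prod_moment N s)\<^sup>2"
    using GG.integral_pair_mult[OF GG.integrable_pair_mult[OF PiM(1) PiM(1)]] PiM(2)
    by (simp add: power2_eq_square)
  have nz: "gamma_prod_moment N s \<noteq> 0"
    by (intro gamma_prod_moment_nonzero one_plus_notin_nonpos_Ints res(1))
  have "gamma_prod_moment N (2 * s) = integral\<^sup>L (distr M borel (\<lambda>\<omega>. \<Prod>j = 1..N. \<gamma> j \<omega>)) (abs_cpow (2 * s))"
    unfolding integral_distr[OF Xm measurable_abs_cpow] by (rule X(2)[symmetric])
  also have "\<dots> = integral\<^sup>L (\<mu> \<Otimes>\<^sub>M (G \<Otimes>\<^sub>M G)) (\<lambda>(\<Lambda>, q). abs_cpow (2 * s) (cmod (Z N \<Lambda>)) * (case q of (g, g') \<Rightarrow> h g * h g'))"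
    unfolding law' by (subst integral_distr[OF Ym measurable_abs_cpow]) (simp only: factor)
  also have "\<dots> = (LINT \<Lambda>|\<mu>. abs_cpow (2 * s) (cmod (Z N \<Lambda>))) * (gamma_prod_moment N s)\<^sup>2"
    unfolding P.integral_pair_mult[OF int] hh ..
  finally show "(LINT \<Lambda>|\<mu>. of_real (cmod (Z N \<Lambda>)) powr (2 * s)) =
           gamma_prod_moment N (2 * s) / (gamma_prod_moment N s)\<^sup>2"
    using nz by (simp add: abs_cpow_def field_simps)
  have "integrable \<mu> (\<lambda>\<Lambda>. abs_cpow (2 * s) (cmod (Z N \<Lambda>)))"
    using nz hh by (intro P.integrable_pair_mult_fst[OF int]) auto
  then show "integrable \<mu> (\<lambda>\<Lambda>. of_real (cmod (Z N \<Lambda>)) powr (2 * s))"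
    by (simp add: abs_cpow_def)
qed

text \<open>In the ratio the Digamma factors and the powers of \<open>A\<close> cancel.\<close>

lemma gamma_prod_moment_ratio_asymptotics:
  assumes s: "1 + s \<notin> \<int>\<^sub>\<le>\<^sub>0" and s2: "1 + 2 * s \<notin> \<int>\<^sub>\<le>\<^sub>0"
  shows "(\<lambda>N. 1 / of_nat N powr (s\<^sup>2) * (gamma_prod_moment N (2 * s) / (gamma_prod_moment N s)\<^sup>2))
           \<longlonglongrightarrow> (barnes_G (1 + s))\<^sup>2 / barnes_G (1 + 2 * s)"
proof -
  define A where "A = complex_of_real (sqrt (exp 1 / (2 * pi)))"
  define D where "D = (\<lambda>N. complex_of_real (\<Sum>j = 1..N. Digamma (real j)))"
  have A: "A powr s \<noteq> 0" by (simp add: A_def)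
  have A2: "A powr (2 * s) = (A powr s)\<^sup>2"
    by (simp add: powr_def exp_double[symmetric] mult.assoc)
  \<comment> \<open>The limit at 2s is divided by the square of the limit at s; the powers of N
    leave 2 s^2 - s^2 = s^2.\<close>
  have T: "(\<lambda>N. (1 / of_nat N powr ((2 * s)\<^sup>2 / 2) * gamma_prod_moment N (2 * s) * exp (- (2 * s) * D N))
          / (1 / of_nat N powr (s\<^sup>2 / 2) * gamma_prod_moment N s * exp (- s * D N))\<^sup>2)
        \<longlonglongrightarrow> inverse (A powr (2 * s) * barnes_G (1 + 2 * s)) / (inverse (A powr s * barnes_G (1 + s)))\<^sup>2"
    unfolding A_def D_def
    using barnes_G_one_plus_nonzero[OF s]
    by (intro tendsto_divide tendsto_power gamma_prod_moment_asymptotics s s2) simp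
  have C: "inverse (A powr (2 * s) * barnes_G (1 + 2 * s)) / (inverse (A powr s * barnes_G (1 + s)))\<^sup>2 =
      (barnes_G (1 + s))\<^sup>2 / barnes_G (1 + 2 * s)"
    using A barnes_G_one_plus_nonzero[OF s] unfolding A2
    by (simp add: power_mult_distrib power_inverse divide_simps)
  have Ev: "\<forall>\<^sub>F N in sequentially.
      (1 / of_nat N powr ((2 * s)\<^sup>2 / 2) * gamma_prod_moment N (2 * s) * exp (- (2 * s) * D N))
          / (1 / of_nat N powr (s\<^sup>2 / 2) * gamma_prod_moment N s * exp (- s * D N))\<^sup>2 =
      1 / of_nat N powr (s\<^sup>2) * (gamma_prod_moment N (2 * s) / (gamma_prod_moment N s)\<^sup>2)"
    using eventually_gt_at_top[of 0]
  proof eventually_elim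
    case (elim N)
    define W where "W = of_nat N powr (s\<^sup>2 / 2)"
    define e where "e = exp (- s * D N)"
    have nz: "W \<noteq> 0" "e \<noteq> 0" using elim by (simp_all add: W_def e_def)
    have "of_nat N powr (s\<^sup>2 / 2 + s\<^sup>2 / 2) = W * W"
      unfolding W_def by (rule powr_add)
    then have W2: "of_nat N powr (s\<^sup>2) = W\<^sup>2"
      by (simp add: power2_eq_square)
    have "of_nat N powr (s\<^sup>2 + s\<^sup>2) = of_nat N powr (s\<^sup>2) * of_nat N powr (s\<^sup>2)"
      by (rule powr_add)
    moreover have "(2 * s)\<^sup>2 / 2 = s\<^sup>2 + s\<^sup>2" by (simp add: power2_eq_square)
    ultimately have W4: "of_nat N powr ((2 * s)\<^sup>2 / 2) = W\<^sup>2 * W\<^sup>2"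
      using W2 by simp
    have "- (2 * s) * D N = 2 * (- s * D N)" by simp
    then have e2: "exp (- (2 * s) * D N) = e\<^sup>2"
      unfolding e_def by (simp only: exp_double)
    have "(1 / (w * w) * m * f) / (1 / w0 * m0 * e0)\<^sup>2 = 1 / w * (m / m0\<^sup>2)"
      if "w = w0\<^sup>2" "f = e0\<^sup>2" "w0 \<noteq> 0" "e0 \<noteq> 0" for w m f w0 m0 e0 :: complex
      using that by (simp add: power2_eq_square)
    from this[OF refl refl nz, of "gamma_prod_moment N (2 * s)" "gamma_prod_moment N s"]
    show ?case
      unfolding W4 e2 W2 W_def[symmetric] e_def[symmetric] .
  qed
  show ?thesis by (rule Lim_transform_eventually[OF T[unfolded C] Ev])
qed

text \<open>For Re s > -1 the only pole in the numerator comes from Gamma(1 + 2s) at s = -1/2, and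
  the denominator has neither poles nor zeros there.\<close>

lemma holomorphic_gamma_prod_moment_ratio:
  "(\<lambda>s. gamma_prod_moment N (2 * s) / (gamma_prod_moment N s)\<^sup>2) holomorphic_on ({s. Re s > -1} - {-1/2})"
proof -
  define S :: "complex set" where "S = {s. Re s > -1} - {-1/2}"
  have S: "1 + s \<notin> \<int>\<^sub>\<le>\<^sub>0" "1 + 2 * s \<notin> \<int>\<^sub>\<le>\<^sub>0" if "s \<in> S" for s
    using that one_plus_notin_nonpos_Ints one_plus_double_notin_nonpos_Ints by (auto simp: S_def)
  have G: "(\<lambda>s. Gamma (of_nat j + f s)) holomorphic_on S"
    if f: "f holomorphic_on S" "\<And>s. s \<in> S \<Longrightarrow> 1 + f s \<notin> \<int>\<^sub>\<le>\<^sub>0" and j: "j \<in> {1..N}" for f j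
  proof (rule holomorphic_Gamma')
    show "(\<lambda>s. of_nat j + f s) holomorphic_on S" by (intro holomorphic_intros f)
    fix s assume "s \<in> S"
    from j obtain n where n: "j = Suc n" by (cases j) auto
    then show "of_nat j + f s \<notin> \<int>\<^sub>\<le>\<^sub>0"
      using one_plus_notin_nonpos_Ints_shift(3)[OF f(2)[OF \<open>s \<in> S\<close>], of n] by (simp add: add_ac)
  qed
  have M: "(\<lambda>s. gamma_prod_moment N (f s)) holomorphic_on S"
    if "f holomorphic_on S" "\<And>s. s \<in> S \<Longrightarrow> 1 + f s \<notin> \<int>\<^sub>\<le>\<^sub>0" for f
    unfolding gamma_prod_moment_def
    by (intro holomorphic_on_prod holomorphic_on_divide G that holomorphic_on_const)
       (auto simp: Gamma_eq_zero_iff of_nat_in_nonpos_Ints_iff)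
  show ?thesis
    unfolding S_def[symmetric]
    by (intro holomorphic_on_divide holomorphic_on_power M holomorphic_intros)
       (use S gamma_prod_moment_nonzero in auto)
qed

text \<open>The identity in law enters as a hypothesis, the second part being a consequence of it
  and the first. The moment of |Z_N| is shown to be finite for Re s > -1/2; further left the limit
  concerns its analytic continuation \<open>E\<close>, unique since the punctured half-plane is
  connected. At s = -1/2 the denominator G(1 + 2s) = G(0) is zero.\<close>

theorem theorem1p4:
  fixes M :: "'a measure" and \<gamma> :: "nat \<Rightarrow> 'a \<Rightarrow> real"
  assumes "prob_space M"
    and "prob_space.indep_vars M (\<lambda>_. borel) \<gamma> {1..}"
    and "\<And>n. n \<ge> 1 \<Longrightarrow> distributed M lborel (\<gamma> n) (\<lambda>t. ennreal (gamma_density (real n) t))"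
  shows
    "(\<forall>s::complex. Re s > -1 \<longrightarrow>
        (\<forall>N. integrable M (\<lambda>\<omega>. complex_of_real (\<Prod>j = 1..N. \<gamma> j \<omega>) powr s)) \<and>
        (\<lambda>N. 1 / of_nat N powr (s\<^sup>2 / 2)
             * (LINT \<omega>|M. complex_of_real (\<Prod>j = 1..N. \<gamma> j \<omega>) powr s)
             * exp (- s * of_real (\<Sum>j = 1..N. Digamma (real j))))
          \<longlonglongrightarrow> inverse (complex_of_real (sqrt (exp 1 / (2 * pi))) powr s * barnes_G (1 + s)))
     \<and>
     (\<forall>H :: nat \<Rightarrow> complex mat measure.
        (\<forall>N\<ge>1. haar_unitary N (H N)) \<longrightarrow>
        (\<forall>N\<ge>1. distr M borel (\<lambda>\<omega>. \<Prod>j = 1..N. \<gamma> j \<omega>) = unitary_gamma_product_law N (H N)) \<longrightarrow>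
        (\<forall>s::complex. Re s > -1/2 \<longrightarrow>
           (\<forall>N\<ge>1. integrable (H N) (\<lambda>\<Lambda>. complex_of_real (cmod (Z N \<Lambda>)) powr (2 * s))) \<and>
           (\<lambda>N. 1 / of_nat N powr (s\<^sup>2)
                * (LINT \<Lambda>|H N. complex_of_real (cmod (Z N \<Lambda>)) powr (2 * s)))
             \<longlonglongrightarrow> (barnes_G (1 + s))\<^sup>2 / barnes_G (1 + 2 * s)) \<and>
        (\<exists>E :: nat \<Rightarrow> complex \<Rightarrow> complex.
           (\<forall>N\<ge>1. E N holomorphic_on ({s. Re s > -1} - {-1/2}) \<and>
              (\<forall>s. Re s > -1/2 \<longrightarrow>
                 E N s = (LINT \<Lambda>|H N. complex_of_real (cmod (Z N \<Lambda>)) powr (2 * s)))) \<and>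
           (\<forall>s. Re s > -1 \<and> s \<noteq> -1/2 \<longrightarrow>
              (\<lambda>N. 1 / of_nat N powr (s\<^sup>2) * E N s)
                \<longlonglongrightarrow> (barnes_G (1 + s))\<^sup>2 / barnes_G (1 + 2 * s))))"
    (is "?gamma_limit \<and> ?unitary_limit")
proof
  show ?gamma_limit
  proof (intro allI impI)
    fix s :: complex assume s: "Re s > -1"
    have X: "integrable M (\<lambda>\<omega>. complex_of_real (\<Prod>j = 1..N. \<gamma> j \<omega>) powr s)"
      "(LINT \<omega>|M. complex_of_real (\<Prod>j = 1..N. \<gamma> j \<omega>) powr s) = gamma_prod_moment N s" for N
    proof -
      have [measurable]: "(\<lambda>\<omega>. \<Prod>j = 1..N. \<gamma> j \<omega>) \<in> borel_measurable M"
        using distributed_measurable[OF assms(3)] by (intro borel_measurable_prod) auto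
      have "AE \<omega> in M. (\<Prod>j = 1..N. \<gamma> j \<omega>) > 0"
        by (rule gamma_product_positive_AE[OF assms(1)]) (rule assms(3))
      then have ae: "AE \<omega> in M. complex_of_real (\<Prod>j = 1..N. \<gamma> j \<omega>) powr s = abs_cpow s (\<Prod>j = 1..N. \<gamma> j \<omega>)"
        by eventually_elim (rule abs_cpow_nonneg[OF less_imp_le])
      have m: "(\<lambda>\<omega>. complex_of_real (\<Prod>j = 1..N. \<gamma> j \<omega>) powr s) \<in> borel_measurable M"
        by (rule measurable_compose[OF _ measurable_of_real_powr]) measurable
      have m': "(\<lambda>\<omega>. abs_cpow s (\<Prod>j = 1..N. \<gamma> j \<omega>)) \<in> borel_measurable M"
        by measurable
      show "integrable M (\<lambda>\<omega>. complex_of_real (\<Prod>j = 1..N. \<gamma> j \<omega>) powr s)"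
        using gamma_product_expectation(1)[OF assms s] integrable_cong_AE[OF m m' ae] by blast
      show "(LINT \<omega>|M. complex_of_real (\<Prod>j = 1..N. \<gamma> j \<omega>) powr s) = gamma_prod_moment N s"
        using gamma_product_expectation(2)[OF assms s] integral_cong_AE[OF m m' ae] by simp
    qed
    show "(\<forall>N. integrable M (\<lambda>\<omega>. complex_of_real (\<Prod>j = 1..N. \<gamma> j \<omega>) powr s)) \<and>
        (\<lambda>N. 1 / of_nat N powr (s\<^sup>2 / 2)
             * (LINT \<omega>|M. complex_of_real (\<Prod>j = 1..N. \<gamma> j \<omega>) powr s)
             * exp (- s * of_real (\<Sum>j = 1..N. Digamma (real j))))
          \<longlonglongrightarrow> inverse (complex_of_real (sqrt (exp 1 / (2 * pi))) powr s * barnes_G (1 + s))"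
      unfolding X(2) using X(1) gamma_prod_moment_asymptotics[OF one_plus_notin_nonpos_Ints[OF s]] by blast
  qed
next
  show ?unitary_limit
  proof (intro allI impI, goal_cases)
    case (1 H)
    \<comment> \<open>The witness is the quotient of closed-form moments, which agrees with the
      expectation wherever the latter was computed.\<close>
    define E where "E = (\<lambda>N s. gamma_prod_moment N (2 * s) / (gamma_prod_moment N s)\<^sup>2)"
    have U: "integrable (H N) (\<lambda>\<Lambda>. complex_of_real (cmod (Z N \<Lambda>)) powr (2 * s))"
      "E N s = (LINT \<Lambda>|H N. complex_of_real (cmod (Z N \<Lambda>)) powr (2 * s))"
      if "Re s > -1/2" "N \<ge> 1" for N s
      using unitary_moment[OF assms, of N "H N" s] 1 that by (auto simp: E_def)
    have L: "(\<lambda>N. 1 / of_nat N powr (s\<^sup>2) * E N s) \<longlonglongrightarrow> (barnes_G (1 + s))\<^sup>2 / barnes_G (1 + 2 * s)"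
      if "Re s > -1" "s \<noteq> -1/2" for s
      unfolding E_def using that
      by (intro gamma_prod_moment_ratio_asymptotics one_plus_notin_nonpos_Ints one_plus_double_notin_nonpos_Ints)
    have "(\<lambda>N. 1 / of_nat N powr (s\<^sup>2) * (LINT \<Lambda>|H N. complex_of_real (cmod (Z N \<Lambda>)) powr (2 * s)))
             \<longlonglongrightarrow> (barnes_G (1 + s))\<^sup>2 / barnes_G (1 + 2 * s)" if s: "Re s > -1/2" for s
    proof (rule Lim_transform_eventually)
      show "(\<lambda>N. 1 / of_nat N powr (s\<^sup>2) * E N s) \<longlonglongrightarrow> (barnes_G (1 + s))\<^sup>2 / barnes_G (1 + 2 * s)"
        using s by (intro L) auto
      show "\<forall>\<^sub>F N in sequentially. 1 / of_nat N powr (s\<^sup>2) * E N s =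
          1 / of_nat N powr (s\<^sup>2) * (LINT \<Lambda>|H N. complex_of_real (cmod (Z N \<Lambda>)) powr (2 * s))"
        using eventually_ge_at_top[of 1] by eventually_elim (simp only: U(2)[OF s])
    qed
    moreover have "E N holomorphic_on ({s. Re s > -1} - {-1/2})" for N
      unfolding E_def by (rule holomorphic_gamma_prod_moment_ratio)
    ultimately show ?case
      using U L by blast
  qed
qed

end
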